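(* Let $\Gamma$ be a finite connected graph, let $A$ be a finite group which is an extension of a subgroup $N$ by a group $Q$, and let $\phi:D(\Gamma)\to A$ be a voltage assignment. Then $\phi$ induces two voltage assignments $\overline{\phi}:D(\Gamma)\to Q$ and $\underline{\phi}:D(\Gamma\times_{\overline{\phi}}Q)\to N$, given by $\overline\phi=\jmath\circ\phi$ and $\underline\phi\langle x,q\rangle=\kappa(q)\phi(x)[\kappa(q\overline\phi(x))]^{-1}$, such that the two covers $\Gamma\times_{\phi}A\to\Gamma$ and $(\Gamma\times_{\overline{\phi}}Q)\times_{\underline{\phi}}N\to\Gamma$ are equivalent as $A$-covers, via the map $$\Xi_\phi:\Gamma\times_\phi A\to(\Gamma\times_{\overline\phi}Q)\times_{\underline\phi}N,\qquad \langle x,g\rangle\mapsto\langle\langle x,\jmath(g)\rangle,\,g[\kappa(\jmath(g))]^{-1}\rangle .$$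
   Context: For a graph $\Gamma$, $V(\Gamma)$ and $D(\Gamma)$ are the sets of vertices and arcs (each edge gives two opposite arcs $x,x^{-1}$); $s(x),t(x)$ are the starting and terminal vertices of $x$. Vertices are regarded as trivial arcs, with $\check D(\Gamma)=V(\Gamma)\sqcup D(\Gamma)$. A graph isomorphism is a bijection $\check D(\Gamma)\to\check D(\Gamma')$ carrying vertices to vertices and arcs to arcs, compatible with $s$, $t$ and arc reversal. A voltage assignment in a finite group $A$ is a map $\phi:D(\Gamma)\to A$ with $\phi(x^{-1})=\phi(x)^{-1}$. The derived graph $\Gamma\times_\phi A$ has vertex set $V(\Gamma)\times A$ and arc set $D(\Gamma)\times A$ (elements $\langle x,g\rangle$; for a trivial arc $x=u$ this means the vertex $(u,g)$), with $s\langle x,g\rangle=(s(x),g)$, $t\langle x,g\rangle=(t(x),g\phi(x))$ and hence $\langle x,g\rangle^{-1}=\langle x^{-1},g\phi(x)\rangle$; it projects to $\Gamma$ by the first coordinate, and $A$ acts by $h\langle x,g\rangle=\langle x,hg\rangle$. Extension: there is a short exact sequence of finite groups $1\to N\to A\xrightarrow{\jmath}Q\to1$ (split or not), with $N$ identified with $\ker\jmath$. A section $\kappa:Q\to A$ is fixed: a function (not necessarily a homomorphism) with $\jmath\circ\kappa=\mathrm{id}_Q$ and $\kappa(1)=1$. The cover $(\Gamma\times_{\overline\phi}Q)\times_{\underline\phi}N\to\Gamma$ is the composite of the projections to $\Gamma\times_{\overline\phi}Q$ and then to $\Gamma$; $A$ acts on it by $(g,\langle\langle x,q\rangle,h\rangle)\mapsto\langle\langle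 x,\jmath(g)q\rangle,\,gh\kappa(q)[\kappa(\jmath(g)q)]^{-1}\rangle$. Two covers of $\Gamma$ are equivalent if there is an isomorphism of covering graphs commuting with the projections to $\Gamma$; as $A$-covers, the isomorphism is moreover compatible with the $A$-actions. *)

theory Defs
  imports
    "HOL-Algebra.Coset"
    "HOL-Algebra.Group_Action"
    "Graph_Theory.Digraph_Component"
    "Graph_Theory.Bidirected_Digraph"
begin

text \<open>
  A graph is a \<^locale>\<open>bidirected_digraph\<close>: vertices and arcs with a fixed-point-free involution
  \<open>arev\<close> on the arcs (and, by library convention, \<open>arev x = x\<close> if \<open>x\<close> is not an arc).  Loops and
  parallel edges are allowed.

  A map on the disjoint union of vertices and arcs that carries vertices to vertices and arcs to
  arcs is given as a pair, its restriction to vertices and its restriction to arcs.  Maps that are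
  given by the same formula on vertices and on arcs (\<open>lift_action\<close>, \<open>iterated_action\<close>, \<open>Xi\<close>
  below) are polymorphic in the type of the cell \<open>x\<close>.
\<close>

definition graph_iso ::
  "('v, 'e) pre_digraph \<Rightarrow> ('e \<Rightarrow> 'e) \<Rightarrow> ('w, 'f) pre_digraph \<Rightarrow> ('f \<Rightarrow> 'f)
    \<Rightarrow> ('v \<Rightarrow> 'w) \<Rightarrow> ('e \<Rightarrow> 'f) \<Rightarrow> bool" where
  "graph_iso \<Gamma> arev \<Delta> arev' fv fa \<longleftrightarrow>
     bij_betw fv (verts \<Gamma>) (verts \<Delta>) \<and>
     bij_betw fa (arcs \<Gamma>) (arcs \<Delta>) \<and>
     (\<forall>x\<in>arcs \<Gamma>. tail \<Delta> (fa x) = fv (tail \<Gamma> x) \<and>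
                  head \<Delta> (fa x) = fv (head \<Gamma> x) \<and>
                  fa (arev x) = arev' (fa x))"

locale voltage_assignment = bidirected_digraph \<Gamma> arev + group A
  for \<Gamma> :: "('v, 'e) pre_digraph" and arev and A (structure) +
  fixes \<phi> :: "'e \<Rightarrow> 'a"
  assumes voltage_closed: "x \<in> arcs \<Gamma> \<Longrightarrow> \<phi> x \<in> carrier A"
    and voltage_rev: "x \<in> arcs \<Gamma> \<Longrightarrow> \<phi> (arev x) = inv (\<phi> x)"

definition derived_graph ::
  "('v, 'e) pre_digraph \<Rightarrow> ('a, 'm) monoid_scheme \<Rightarrow> ('e \<Rightarrow> 'a) \<Rightarrow> ('v \<times> 'a, 'e \<times> 'a) pre_digraph" where
  "derived_graph \<Gamma> A \<phi> =
     \<lparr> verts = verts \<Gamma> \<times> carrier A,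
       arcs = arcs \<Gamma> \<times> carrier A,
       tail = (\<lambda>(x, g). (tail \<Gamma> x, g)),
       head = (\<lambda>(x, g). (head \<Gamma> x, g \<otimes>\<^bsub>A\<^esub> \<phi> x)) \<rparr>"

definition derived_rev ::
  "('v, 'e) pre_digraph \<Rightarrow> ('e \<Rightarrow> 'e) \<Rightarrow> ('a, 'm) monoid_scheme \<Rightarrow> ('e \<Rightarrow> 'a) \<Rightarrow> 'e \<times> 'a \<Rightarrow> 'e \<times> 'a" where
  "derived_rev \<Gamma> arev A \<phi> =
     (\<lambda>(x, g). if x \<in> arcs \<Gamma> \<and> g \<in> carrier A then (arev x, g \<otimes>\<^bsub>A\<^esub> \<phi> x) else (x, g))"

text \<open>A graph with a projection to a base graph and maps \<open>g \<mapsto> vact g\<close>, \<open>g \<mapsto> aact g\<close> for a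
  group acting on vertices and arcs.\<close>

record ('v, 'e, 'w, 'f, 'a) acted_graph =
  total :: "('v, 'e) pre_digraph"
  total_rev :: "'e \<Rightarrow> 'e"
  vproj :: "'v \<Rightarrow> 'w"
  aproj :: "'e \<Rightarrow> 'f"
  vact :: "'a \<Rightarrow> 'v \<Rightarrow> 'v"
  aact :: "'a \<Rightarrow> 'e \<Rightarrow> 'e"

definition covers ::
  "('v, 'e, 'w, 'f, 'a) acted_graph \<Rightarrow> ('w, 'f) pre_digraph \<Rightarrow> ('f \<Rightarrow> 'f) \<Rightarrow> bool" where
  "covers C \<Gamma> arev \<longleftrightarrow>
     bidirected_digraph \<Gamma> arev \<and>
     bidirected_digraph (total C) (total_rev C) \<and>
     vproj C ` verts (total C) = verts \<Gamma> \<and>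
     (\<forall>x\<in>arcs (total C). aproj C x \<in> arcs \<Gamma> \<and>
        tail \<Gamma> (aproj C x) = vproj C (tail (total C) x) \<and>
        head \<Gamma> (aproj C x) = vproj C (head (total C) x) \<and>
        aproj C (total_rev C x) = arev (aproj C x)) \<and>
     (\<forall>u\<in>verts (total C). bij_betw (aproj C) (out_arcs (total C) u) (out_arcs \<Gamma> (vproj C u)))"

text \<open>An \<open>A\<close>-cover: \<open>A\<close> acts by graph automorphisms over the base, regularly on each fibre.  The
  library's \<^locale>\<open>group_action\<close> requires extensional maps, hence the restrictions.\<close>

definition group_cover ::
  "('a, 'm) monoid_scheme \<Rightarrow> ('v, 'e, 'w, 'f, 'a) acted_graph \<Rightarrow> ('w, 'f) pre_digraph \<Rightarrow> ('f \<Rightarrow> 'f) \<Rightarrow> bool" where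
  "group_cover A C \<Gamma> arev \<longleftrightarrow>
     covers C \<Gamma> arev \<and>
     group_action A (verts (total C)) (\<lambda>g. restrict (vact C g) (verts (total C))) \<and>
     group_action A (arcs (total C)) (\<lambda>g. restrict (aact C g) (arcs (total C))) \<and>
     (\<forall>g\<in>carrier A.
        graph_iso (total C) (total_rev C) (total C) (total_rev C) (vact C g) (aact C g) \<and>
        (\<forall>u\<in>verts (total C). vproj C (vact C g u) = vproj C u) \<and>
        (\<forall>x\<in>arcs (total C). aproj C (aact C g x) = aproj C x)) \<and>
     (\<forall>u\<in>verts (total C). \<forall>v\<in>verts (total C).
        vproj C u = vproj C v \<longrightarrow> (\<exists>!g. g \<in> carrier A \<and> vact C g u = v)) \<and>
     (\<forall>x\<in>arcs (total C). \<forall>y\<in>arcs (total C).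
        aproj C x = aproj C y \<longrightarrow> (\<exists>!g. g \<in> carrier A \<and> aact C g x = y))"

definition group_cover_equivalence ::
  "('a, 'm) monoid_scheme \<Rightarrow> ('w, 'f) pre_digraph \<Rightarrow> ('f \<Rightarrow> 'f)
    \<Rightarrow> ('v, 'e, 'w, 'f, 'a) acted_graph \<Rightarrow> ('v', 'e', 'w, 'f, 'a) acted_graph
    \<Rightarrow> ('v \<Rightarrow> 'v') \<Rightarrow> ('e \<Rightarrow> 'e') \<Rightarrow> bool" where
  "group_cover_equivalence A \<Gamma> arev C D fv fa \<longleftrightarrow>
     group_cover A C \<Gamma> arev \<and> group_cover A D \<Gamma> arev \<and>
     graph_iso (total C) (total_rev C) (total D) (total_rev D) fv fa \<and>
     (\<forall>u\<in>verts (total C). vproj D (fv u) = vproj C u) \<and>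
     (\<forall>x\<in>arcs (total C). aproj D (fa x) = aproj C x) \<and>
     (\<forall>g\<in>carrier A. \<forall>u\<in>verts (total C). fv (vact C g u) = vact D g (fv u)) \<and>
     (\<forall>g\<in>carrier A. \<forall>x\<in>arcs (total C). fa (aact C g x) = aact D g (fa x))"

definition lift_action :: "('a, 'm) monoid_scheme \<Rightarrow> 'a \<Rightarrow> 'x \<times> 'a \<Rightarrow> 'x \<times> 'a" where
  "lift_action A h = (\<lambda>(x, g). (x, h \<otimes>\<^bsub>A\<^esub> g))"

definition derived_cover ::
  "('v, 'e) pre_digraph \<Rightarrow> ('e \<Rightarrow> 'e) \<Rightarrow> ('a, 'm) monoid_scheme \<Rightarrow> ('e \<Rightarrow> 'a)
    \<Rightarrow> ('v \<times> 'a, 'e \<times> 'a, 'v, 'e, 'a) acted_graph" where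
  "derived_cover \<Gamma> arev A \<phi> =
     \<lparr> total = derived_graph \<Gamma> A \<phi>,
       total_rev = derived_rev \<Gamma> arev A \<phi>,
       vproj = fst, aproj = fst,
       vact = lift_action A, aact = lift_action A \<rparr>"

definition quotient_voltage :: "('a \<Rightarrow> 'q) \<Rightarrow> ('e \<Rightarrow> 'a) \<Rightarrow> 'e \<Rightarrow> 'q" where
  "quotient_voltage j \<phi> = j \<circ> \<phi>"

definition kernel_voltage ::
  "('a, 'm) monoid_scheme \<Rightarrow> ('q, 'n) monoid_scheme \<Rightarrow> ('a \<Rightarrow> 'q) \<Rightarrow> ('q \<Rightarrow> 'a) \<Rightarrow> ('e \<Rightarrow> 'a)
    \<Rightarrow> 'e \<times> 'q \<Rightarrow> 'a" where
  "kernel_voltage A Q j \<kappa> \<phi> =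
     (\<lambda>(x, q). \<kappa> q \<otimes>\<^bsub>A\<^esub> \<phi> x \<otimes>\<^bsub>A\<^esub> inv\<^bsub>A\<^esub> (\<kappa> (q \<otimes>\<^bsub>Q\<^esub> quotient_voltage j \<phi> x)))"

definition iterated_action ::
  "('a, 'm) monoid_scheme \<Rightarrow> ('q, 'n) monoid_scheme \<Rightarrow> ('a \<Rightarrow> 'q) \<Rightarrow> ('q \<Rightarrow> 'a)
    \<Rightarrow> 'a \<Rightarrow> ('x \<times> 'q) \<times> 'a \<Rightarrow> ('x \<times> 'q) \<times> 'a" where
  "iterated_action A Q j \<kappa> g =
     (\<lambda>((x, q), h). ((x, j g \<otimes>\<^bsub>Q\<^esub> q),
        g \<otimes>\<^bsub>A\<^esub> h \<otimes>\<^bsub>A\<^esub> \<kappa> q \<otimes>\<^bsub>A\<^esub> inv\<^bsub>A\<^esub> (\<kappa> (j g \<otimes>\<^bsub>Q\<^esub> q))))"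

definition iterated_cover ::
  "('v, 'e) pre_digraph \<Rightarrow> ('e \<Rightarrow> 'e) \<Rightarrow> ('a, 'm) monoid_scheme \<Rightarrow> 'a set \<Rightarrow> ('q, 'n) monoid_scheme
    \<Rightarrow> ('a \<Rightarrow> 'q) \<Rightarrow> ('q \<Rightarrow> 'a) \<Rightarrow> ('e \<Rightarrow> 'a)
    \<Rightarrow> (('v \<times> 'q) \<times> 'a, ('e \<times> 'q) \<times> 'a, 'v, 'e, 'a) acted_graph" where
  "iterated_cover \<Gamma> arev A N Q j \<kappa> \<phi> =
     \<lparr> total = derived_graph (derived_graph \<Gamma> Q (quotient_voltage j \<phi>))
                 (A\<lparr>carrier := N\<rparr>) (kernel_voltage A Q j \<kappa> \<phi>),
       total_rev = derived_rev (derived_graph \<Gamma> Q (quotient_voltage j \<phi>))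
                     (derived_rev \<Gamma> arev Q (quotient_voltage j \<phi>))
                     (A\<lparr>carrier := N\<rparr>) (kernel_voltage A Q j \<kappa> \<phi>),
       vproj = fst \<circ> fst, aproj = fst \<circ> fst,
       vact = iterated_action A Q j \<kappa>, aact = iterated_action A Q j \<kappa> \<rparr>"

definition Xi :: "('a, 'm) monoid_scheme \<Rightarrow> ('a \<Rightarrow> 'q) \<Rightarrow> ('q \<Rightarrow> 'a) \<Rightarrow> 'x \<times> 'a \<Rightarrow> ('x \<times> 'q) \<times> 'a" where
  "Xi A j \<kappa> = (\<lambda>(x, g). ((x, j g), g \<otimes>\<^bsub>A\<^esub> inv\<^bsub>A\<^esub> (\<kappa> (j g))))"

end

theory Submission
  imports Defs
begin

text \<open>
  Everything rests on the decomposition of an element of the extension along the section: the map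
  \<open>g \<mapsto> (j g, g \<otimes> inv (\<kappa> (j g)))\<close> is a bijection from \<open>A\<close> onto \<open>Q \<times> N\<close>, with inverse
  \<open>(q, n) \<mapsto> n \<otimes> \<kappa> q\<close>, because \<open>g\<close> and \<open>\<kappa> (j g)\<close> have the same image in \<open>Q\<close>
  (\<open>Xi_bij\<close>).  Both the voltage \<open>kernel_voltage\<close> and the action \<open>iterated_action\<close> are what
  right multiplication by \<open>\<phi> x\<close> and left multiplication by elements of \<open>A\<close> become in these
  coordinates: in the products involved, the factor \<open>inv (\<kappa> (j g))\<close> of the \<open>N\<close>-coordinate
  cancels against \<open>\<kappa> (j g)\<close> (\<open>Xi_head\<close>, \<open>Xi_rev\<close>, \<open>Xi_equivariant\<close>).

  The covering properties of the iterated cover are then never checked on its formulas.  An ordinary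
  derived cover is an \<open>A\<close>-cover by left translation in the group coordinate
  (\<open>group_cover_derived_cover\<close>), and being an \<open>A\<close>-cover is invariant under bijections that respect
  the graph structure, the projections and the action (\<open>group_cover_transport\<close>), so the property
  passes along \<open>Xi\<close> from the derived cover to the iterated one.  What has to be known
  beforehand about the iterated construction is only that it is a graph, that is, that
  \<open>kernel_voltage\<close> is a voltage assignment.
\<close>

section \<open>Actions that are regular on fibres\<close>

text \<open>
  The library's \<^locale>\<open>group_action\<close> is a homomorphism into a group of extensional bijections.
  The pointwise laws below are equivalent to it and much easier to verify and to transport, since
  bijectivity follows from invertibility in the group.
\<close>

lemma group_action_restrict_iff:
  assumes "group A"
  shows "group_action A X (\<lambda>g. restrict (act g) X) \<longleftrightarrow>
    (\<forall>g\<in>carrier A. \<forall>x\<in>X. act g x \<in> X) \<and>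
    (\<forall>x\<in>X. act \<one>\<^bsub>A\<^esub> x = x) \<and>
    (\<forall>g\<in>carrier A. \<forall>h\<in>carrier A. \<forall>x\<in>X. act (g \<otimes>\<^bsub>A\<^esub> h) x = act g (act h x))"
    (is "_ \<longleftrightarrow> ?laws")
proof
  assume "group_action A X (\<lambda>g. restrict (act g) X)"
  then interpret group_action A X "\<lambda>g. restrict (act g) X" .
  have closed: "act g x \<in> X" if "g \<in> carrier A" "x \<in> X" for g x
    using element_image[OF that refl] that by simp
  moreover have "act \<one>\<^bsub>A\<^esub> x = x" if "x \<in> X" for x
    using fun_cong[OF id_eq_one, of x] that by simp
  moreover have "act (g \<otimes>\<^bsub>A\<^esub> h) x = act g (act h x)"
    if "g \<in> carrier A" "h \<in> carrier A" "x \<in> X" for g h x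
    using composition_rule[OF that(3,1,2)] that closed by simp
  ultimately show ?laws by blast
next
  assume laws: ?laws
  interpret A: group A by fact
  have inverse: "act (inv\<^bsub>A\<^esub> g) (act g x) = x" "act g (act (inv\<^bsub>A\<^esub> g) x) = x"
    if "g \<in> carrier A" "x \<in> X" for g x
    using laws that A.l_inv A.r_inv A.inv_closed by metis+
  have bij: "bij_betw (act g) X X" if "g \<in> carrier A" for g
    by (rule bij_betw_byWitness[where f' = "act (inv\<^bsub>A\<^esub> g)"]) (use laws inverse that in auto)
  then have Bij: "restrict (act g) X \<in> Bij X" if "g \<in> carrier A" for g
    using that by (simp add: Bij_def cong: bij_betw_cong)
  have "restrict (act (g \<otimes>\<^bsub>A\<^esub> h)) X = compose X (restrict (act g) X) (restrict (act h) X)"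
    if "g \<in> carrier A" "h \<in> carrier A" for g h
    using that laws by (auto simp: compose_def fun_eq_iff)
  then have "(\<lambda>g. restrict (act g) X) \<in> hom A (BijGroup X)"
    using Bij by (auto simp: hom_def BijGroup_def)
  then show "group_action A X (\<lambda>g. restrict (act g) X)"
    by (simp add: group_action_def group_hom_def group_hom_axioms_def group_BijGroup assms)
qed

definition regular_on_fibres ::
  "('a, 'm) monoid_scheme \<Rightarrow> 'x set \<Rightarrow> ('x \<Rightarrow> 'b) \<Rightarrow> ('a \<Rightarrow> 'x \<Rightarrow> 'x) \<Rightarrow> bool" where
  "regular_on_fibres A X p act \<longleftrightarrow>
     group_action A X (\<lambda>g. restrict (act g) X) \<and>
     (\<forall>g\<in>carrier A. \<forall>x\<in>X. p (act g x) = p x) \<and>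
     (\<forall>x\<in>X. \<forall>y\<in>X. p x = p y \<longrightarrow> (\<exists>!g. g \<in> carrier A \<and> act g x = y))"

lemma regular_on_fibres_laws:
  assumes "group A" "regular_on_fibres A X p act"
  shows "\<And>g x. g \<in> carrier A \<Longrightarrow> x \<in> X \<Longrightarrow> act g x \<in> X"
    and "\<And>x. x \<in> X \<Longrightarrow> act \<one>\<^bsub>A\<^esub> x = x"
    and "\<And>g h x. g \<in> carrier A \<Longrightarrow> h \<in> carrier A \<Longrightarrow> x \<in> X \<Longrightarrow>
      act (g \<otimes>\<^bsub>A\<^esub> h) x = act g (act h x)"
    and "\<And>g x. g \<in> carrier A \<Longrightarrow> x \<in> X \<Longrightarrow> p (act g x) = p x"
  using assms(2) by (simp_all add: regular_on_fibres_def group_action_restrict_iff[OF assms(1)])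

lemma regular_on_fibres_lift_action:
  assumes "group A"
  shows "regular_on_fibres A (X \<times> carrier A) fst (lift_action A)"
proof -
  interpret A: group A by fact
  have "\<exists>!k. k \<in> carrier A \<and> k \<otimes>\<^bsub>A\<^esub> g = h" if "g \<in> carrier A" "h \<in> carrier A" for g h
    by (rule ex1I[where a = "h \<otimes>\<^bsub>A\<^esub> inv\<^bsub>A\<^esub> g"]) (use that in \<open>auto simp: A.m_assoc\<close>)
  then show ?thesis
    by (auto simp: regular_on_fibres_def group_action_restrict_iff[OF assms] lift_action_def
        A.m_assoc)
qed

text \<open>
  On \<open>Y\<close> the map \<open>act' g\<close> is the conjugate of \<open>act g\<close> by \<open>f\<close>, so every law about points of \<open>Y\<close>
  is the image under \<open>f\<close> of the same law about points of \<open>X\<close>.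
\<close>

lemma regular_on_fibres_transport:
  assumes "group A" and regular: "regular_on_fibres A X p act"
    and bij: "bij_betw f X Y"
    and proj: "\<And>x. x \<in> X \<Longrightarrow> p' (f x) = p x"
    and equivariant: "\<And>g x. g \<in> carrier A \<Longrightarrow> x \<in> X \<Longrightarrow> f (act g x) = act' g (f x)"
  shows "regular_on_fibres A Y p' act'"
proof -
  interpret A: group A by fact
  note laws = regular_on_fibres_laws[OF \<open>group A\<close> regular]
  have Y: "Y = f ` X" and inj: "inj_on f X"
    using bij by (auto simp: bij_betw_def)
  have act': "act' g (f x) = f (act g x)" if "g \<in> carrier A" "x \<in> X" for g x
    using equivariant that by simp
  have "\<exists>!g. g \<in> carrier A \<and> act' g (f x) = f y" if "x \<in> X" "y \<in> X" "p x = p y" for x y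
  proof -
    have "act' g (f x) = f y \<longleftrightarrow> act g x = y" if "g \<in> carrier A" for g
      using that \<open>x \<in> X\<close> \<open>y \<in> X\<close> laws(1) inj by (auto simp: act' inj_on_eq_iff)
    then show ?thesis
      using regular that by (simp add: regular_on_fibres_def cong: conj_cong)
  qed
  then show ?thesis
    unfolding regular_on_fibres_def group_action_restrict_iff[OF \<open>group A\<close>] Y
    using laws by (simp add: act' proj)
qed

section \<open>Invariance of group covers under equivalence\<close>

text \<open>
  For maps that already act as a group, the bijectivity part of \<open>graph_iso\<close> is automatic; only the
  compatibility with endpoints and reversal remains.
\<close>

lemma group_cover_iff:
  assumes "group A"
  shows "group_cover A C \<Gamma> arev \<longleftrightarrow>
     covers C \<Gamma> arev \<and>
     regular_on_fibres A (verts (total C)) (vproj C) (vact C) \<and>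
     regular_on_fibres A (arcs (total C)) (aproj C) (aact C) \<and>
     (\<forall>g\<in>carrier A. \<forall>x\<in>arcs (total C).
        tail (total C) (aact C g x) = vact C g (tail (total C) x) \<and>
        head (total C) (aact C g x) = vact C g (head (total C) x) \<and>
        aact C g (total_rev C x) = total_rev C (aact C g x))"
proof -
  have "bij_betw (act g) X X" if "group_action A X (\<lambda>g. restrict (act g) X)" "g \<in> carrier A"
    for g X and act :: "'a \<Rightarrow> 'x \<Rightarrow> 'x"
    using group_action.bij_prop0[OF that] by (simp add: Bij_def cong: bij_betw_cong)
  from this[of "verts (total C)" "vact C"] this[of "arcs (total C)" "aact C"]
  have "(\<forall>g\<in>carrier A. graph_iso (total C) (total_rev C) (total C) (total_rev C)
        (vact C g) (aact C g)) \<longleftrightarrow>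
     (\<forall>g\<in>carrier A. \<forall>x\<in>arcs (total C).
        tail (total C) (aact C g x) = vact C g (tail (total C) x) \<and>
        head (total C) (aact C g x) = vact C g (head (total C) x) \<and>
        aact C g (total_rev C x) = total_rev C (aact C g x))"
    if "group_action A (verts (total C)) (\<lambda>g. restrict (vact C g) (verts (total C)))"
      "group_action A (arcs (total C)) (\<lambda>g. restrict (aact C g) (arcs (total C)))"
    using that by (simp add: graph_iso_def)
  then show ?thesis
    unfolding group_cover_def regular_on_fibres_def ball_conj_distrib by argo
qed

text \<open>
  Unique lifting of out-arcs transfers because an isomorphism of graphs maps the star of \<open>u\<close>
  bijectively onto the star of its image, compatibly with the projections.
\<close>

lemma covers_transport:
  assumes cover: "covers C \<Gamma> arev"
    and graph: "bidirected_digraph (total D) (total_rev D)"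
    and iso: "graph_iso (total C) (total_rev C) (total D) (total_rev D) fv fa"
    and vproj: "\<And>u. u \<in> verts (total C) \<Longrightarrow> vproj D (fv u) = vproj C u"
    and aproj: "\<And>x. x \<in> arcs (total C) \<Longrightarrow> aproj D (fa x) = aproj C x"
  shows "covers D \<Gamma> arev"
proof -
  interpret C: bidirected_digraph "total C" "total_rev C"
    using cover by (simp add: covers_def)
  have V: "verts (total D) = fv ` verts (total C)" and inj_fv: "inj_on fv (verts (total C))"
    and E: "arcs (total D) = fa ` arcs (total C)" and inj_fa: "inj_on fa (arcs (total C))"
    using iso by (auto simp: graph_iso_def bij_betw_def)
  have fa: "tail (total D) (fa x) = fv (tail (total C) x)"
    "head (total D) (fa x) = fv (head (total C) x)"
    "total_rev D (fa x) = fa (total_rev C x)" if "x \<in> arcs (total C)" for x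
    using iso that by (auto simp: graph_iso_def)
  have "bij_betw (aproj D) (out_arcs (total D) (fv u)) (out_arcs \<Gamma> (vproj D (fv u)))"
    if u: "u \<in> verts (total C)" for u
  proof -
    have star: "out_arcs (total D) (fv u) = fa ` out_arcs (total C) u"
      using u by (auto simp: out_arcs_def E fa inj_on_eq_iff[OF inj_fv])
    have "bij_betw fa (out_arcs (total C) u) (out_arcs (total D) (fv u))"
      unfolding star by (rule inj_on_imp_bij_betw, rule inj_on_subset[OF inj_fa])
        (auto simp: out_arcs_def)
    moreover have "bij_betw (aproj D \<circ> fa) (out_arcs (total C) u) (out_arcs \<Gamma> (vproj C u))"
      using cover u by (subst bij_betw_cong[where g = "aproj C"]) (auto simp: aproj covers_def)
    ultimately show ?thesis
      by (simp add: bij_betw_comp_iff[symmetric] vproj u)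
  qed
  moreover have "vproj D ` verts (total D) = verts \<Gamma>"
    using cover by (simp add: V image_image vproj covers_def)
  ultimately show ?thesis
    using cover graph by (simp add: covers_def E V fa vproj aproj)
qed

lemma group_cover_transport:
  assumes "group A" and cover: "group_cover A C \<Gamma> arev"
    and graph: "bidirected_digraph (total D) (total_rev D)"
    and iso: "graph_iso (total C) (total_rev C) (total D) (total_rev D) fv fa"
    and vproj: "\<And>u. u \<in> verts (total C) \<Longrightarrow> vproj D (fv u) = vproj C u"
    and aproj: "\<And>x. x \<in> arcs (total C) \<Longrightarrow> aproj D (fa x) = aproj C x"
    and vact: "\<And>g u. g \<in> carrier A \<Longrightarrow> u \<in> verts (total C) \<Longrightarrow> fv (vact C g u) = vact D g (fv u)"
    and aact: "\<And>g x. g \<in> carrier A \<Longrightarrow> x \<in> arcs (total C) \<Longrightarrow> fa (aact C g x) = aact D g (fa x)"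
  shows "group_cover A D \<Gamma> arev"
proof -
  have covers: "covers C \<Gamma> arev"
    and regular: "regular_on_fibres A (verts (total C)) (vproj C) (vact C)"
      "regular_on_fibres A (arcs (total C)) (aproj C) (aact C)"
    using cover unfolding group_cover_iff[OF \<open>group A\<close>] by blast+
  have compatible: "tail (total C) (aact C g x) = vact C g (tail (total C) x)"
      "head (total C) (aact C g x) = vact C g (head (total C) x)"
      "aact C g (total_rev C x) = total_rev C (aact C g x)"
    if "g \<in> carrier A" "x \<in> arcs (total C)" for g x
    using cover that unfolding group_cover_iff[OF \<open>group A\<close>] by blast+
  interpret C: bidirected_digraph "total C" "total_rev C"
    using covers by (simp add: covers_def)
  have bij: "bij_betw fv (verts (total C)) (verts (total D))"
    "bij_betw fa (arcs (total C)) (arcs (total D))"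
    using iso by (auto simp: graph_iso_def)
  have fa: "tail (total D) (fa x) = fv (tail (total C) x)"
    "head (total D) (fa x) = fv (head (total C) x)"
    "total_rev D (fa x) = fa (total_rev C x)" if "x \<in> arcs (total C)" for x
    using iso that by (auto simp: graph_iso_def)
  note closed = regular_on_fibres_laws(1)[OF \<open>group A\<close> regular(2)]
  have "tail (total D) (aact D g y) = vact D g (tail (total D) y) \<and>
      head (total D) (aact D g y) = vact D g (head (total D) y) \<and>
      aact D g (total_rev D y) = total_rev D (aact D g y)"
    if g: "g \<in> carrier A" and "y \<in> arcs (total D)" for g y
  proof -
    obtain x where x: "x \<in> arcs (total C)" "y = fa x"
      using \<open>y \<in> arcs (total D)\<close> bij(2) by (auto simp: bij_betw_def)
    show ?thesis
      using g x closed[OF g x(1)]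
      by (simp add: fa compatible flip: aact vact)
  qed
  moreover have "covers D \<Gamma> arev"
    by (rule covers_transport[OF covers graph iso vproj aproj])
  moreover have "regular_on_fibres A (verts (total D)) (vproj D) (vact D)"
    by (rule regular_on_fibres_transport[OF \<open>group A\<close> regular(1) bij(1)])
      (fact vproj vact)+
  moreover have "regular_on_fibres A (arcs (total D)) (aproj D) (aact D)"
    by (rule regular_on_fibres_transport[OF \<open>group A\<close> regular(2) bij(2)])
      (fact aproj aact)+
  ultimately show ?thesis
    unfolding group_cover_iff[OF \<open>group A\<close>] by blast
qed

section \<open>Derived graphs\<close>

lemma verts_derived_graph [simp]: "verts (derived_graph \<Gamma> A \<phi>) = verts \<Gamma> \<times> carrier A"
  and arcs_derived_graph [simp]: "arcs (derived_graph \<Gamma> A \<phi>) = arcs \<Gamma> \<times> carrier A"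
  and tail_derived_graph [simp]: "tail (derived_graph \<Gamma> A \<phi>) (x, g) = (tail \<Gamma> x, g)"
  and head_derived_graph [simp]:
    "head (derived_graph \<Gamma> A \<phi>) (x, g) = (head \<Gamma> x, g \<otimes>\<^bsub>A\<^esub> \<phi> x)"
  by (simp_all add: derived_graph_def)

lemma derived_rev_arc [simp]:
  "x \<in> arcs \<Gamma> \<Longrightarrow> g \<in> carrier A \<Longrightarrow> derived_rev \<Gamma> arev A \<phi> (x, g) = (arev x, g \<otimes>\<^bsub>A\<^esub> \<phi> x)"
  by (simp add: derived_rev_def)

context voltage_assignment
begin

lemma voltage_rev_cancel:
  "x \<in> arcs \<Gamma> \<Longrightarrow> g \<in> carrier A \<Longrightarrow> g \<otimes>\<^bsub>A\<^esub> \<phi> x \<otimes>\<^bsub>A\<^esub> \<phi> (arev x) = g"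
  by (simp add: voltage_rev voltage_closed m_assoc)

lemma bidirected_derived_graph: "bidirected_digraph (derived_graph \<Gamma> A \<phi>) (derived_rev \<Gamma> arev A \<phi>)"
proof -
  interpret wf: wf_digraph "derived_graph \<Gamma> A \<phi>"
    by unfold_locales (auto simp: voltage_closed)
  show ?thesis
  proof (rule wf.bidirected_digraphI)
    fix y assume "y \<notin> arcs (derived_graph \<Gamma> A \<phi>)"
    then show "derived_rev \<Gamma> arev A \<phi> y = y"
      by (cases y) (auto simp: derived_rev_def)
  qed (auto simp: voltage_closed voltage_rev_cancel arev_neq)
qed

lemma covers_derived_cover: "covers (derived_cover \<Gamma> arev A \<phi>) \<Gamma> arev"
proof -
  have "bij_betw fst (out_arcs (derived_graph \<Gamma> A \<phi>) (v, g)) (out_arcs \<Gamma> v)"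
    if "g \<in> carrier A" for v g
    by (rule bij_betw_byWitness[where f' = "\<lambda>x. (x, g)"]) (use that in auto)
  then show ?thesis
    using bidirected_derived_graph bidirected_digraph one_closed
    by (auto simp: covers_def derived_cover_def)
qed

text \<open>
  Left translations commute with the right multiplications by voltages, so they act by graph
  automorphisms.
\<close>

lemma group_cover_derived_cover: "group_cover A (derived_cover \<Gamma> arev A \<phi>) \<Gamma> arev"
  using covers_derived_cover
  by (auto simp: group_cover_iff[OF is_group] derived_cover_def
      regular_on_fibres_lift_action[OF is_group])
    (auto simp: lift_action_def voltage_closed m_assoc)

end

section \<open>Coordinates on a group extension\<close>

locale extension_with_section = A: group A + Q: group Q
  for A :: "('a, 'm) monoid_scheme" and Q :: "('q, 'n) monoid_scheme" +
  fixes j :: "'a \<Rightarrow> 'q" and \<kappa> :: "'q \<Rightarrow> 'a"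
  assumes projection_hom: "j \<in> hom A Q"
    and section_closed [simp]: "q \<in> carrier Q \<Longrightarrow> \<kappa> q \<in> carrier A"
    and projection_section [simp]: "q \<in> carrier Q \<Longrightarrow> j (\<kappa> q) = q"
begin

sublocale j: group_hom A Q j
  by unfold_locales (rule projection_hom)

lemma section_quotient_in_kernel:
  assumes "a \<in> carrier A" "q \<in> carrier Q" "j a = q"
  shows "a \<otimes>\<^bsub>A\<^esub> inv\<^bsub>A\<^esub> (\<kappa> q) \<in> kernel A Q j"
  using assms by (simp add: kernel_def)

lemma Xi_bij: "bij_betw (Xi A j \<kappa>) (X \<times> carrier A) ((X \<times> carrier Q) \<times> kernel A Q j)"
proof (rule bij_betw_byWitness[where f' = "\<lambda>((x, q), n). (x, n \<otimes>\<^bsub>A\<^esub> \<kappa> q)"])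
  show "\<forall>y\<in>X \<times> carrier A. (\<lambda>((x, q), n). (x, n \<otimes>\<^bsub>A\<^esub> \<kappa> q)) (Xi A j \<kappa> y) = y"
    by (auto simp: Xi_def A.m_assoc)
  show "\<forall>z\<in>(X \<times> carrier Q) \<times> kernel A Q j. Xi A j \<kappa> ((\<lambda>((x, q), n). (x, n \<otimes>\<^bsub>A\<^esub> \<kappa> q)) z) = z"
    by (auto simp: Xi_def kernel_def A.m_assoc)
  show "Xi A j \<kappa> ` (X \<times> carrier A) \<subseteq> (X \<times> carrier Q) \<times> kernel A Q j"
    by (auto simp: Xi_def section_quotient_in_kernel)
  show "(\<lambda>((x, q), n). (x, n \<otimes>\<^bsub>A\<^esub> \<kappa> q)) ` ((X \<times> carrier Q) \<times> kernel A Q j) \<subseteq> X \<times> carrier A"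
    by (auto simp: kernel_def)
qed

lemma inv_mult_cancel_left:
  assumes "a \<in> carrier A" "b \<in> carrier A"
  shows "inv\<^bsub>A\<^esub> a \<otimes>\<^bsub>A\<^esub> (a \<otimes>\<^bsub>A\<^esub> b) = b"
  using assms by (simp add: A.m_assoc[symmetric])

text \<open>
  The iterated action recovers \<open>g\<close> from its coordinates as \<open>n \<otimes> \<kappa> q\<close>, multiplies it by \<open>h\<close> on the
  left, and takes coordinates again.
\<close>

lemma Xi_equivariant:
  assumes "h \<in> carrier A" "g \<in> carrier A"
  shows "Xi A j \<kappa> (lift_action A h (x, g)) = iterated_action A Q j \<kappa> h (Xi A j \<kappa> (x, g))"
  using assms by (simp add: Xi_def lift_action_def iterated_action_def A.m_assoc)

end

section \<open>Factoring a voltage assignment through an extension\<close>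

locale extension_voltage =
  extension_with_section A Q j \<kappa> + voltage_assignment \<Gamma> arev A \<phi>
  for \<Gamma> :: "('v, 'e) pre_digraph" and arev and A :: "('a, 'm) monoid_scheme"
    and Q :: "('q, 'n) monoid_scheme" and j \<kappa> and \<phi> :: "'e \<Rightarrow> 'a"
begin

lemma quotient_voltage_assignment: "voltage_assignment \<Gamma> arev Q (quotient_voltage j \<phi>)"
  by unfold_locales (auto simp: quotient_voltage_def voltage_closed voltage_rev)

sublocale Q: voltage_assignment \<Gamma> arev Q "quotient_voltage j \<phi>"
  by (rule quotient_voltage_assignment)

abbreviation "Q_graph \<equiv> derived_graph \<Gamma> Q (quotient_voltage j \<phi>)"
abbreviation "Q_rev \<equiv> derived_rev \<Gamma> arev Q (quotient_voltage j \<phi>)"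
abbreviation "N_group \<equiv> A\<lparr>carrier := kernel A Q j\<rparr>"

text \<open>
  The voltage \<open>\<kappa> q \<otimes> \<phi> x \<otimes> inv (\<kappa> (q \<otimes> j (\<phi> x)))\<close> compares lifting \<open>q\<close> and
  then following \<open>x\<close> with following \<open>x\<close> and then lifting.  The two agree in \<open>Q\<close>, hence the
  value is in the kernel, and traversing the arc backwards exchanges the two.
\<close>

lemma kernel_voltage_assignment:
  "voltage_assignment Q_graph Q_rev N_group (kernel_voltage A Q j \<kappa> \<phi>)"
proof -
  interpret base: bidirected_digraph Q_graph Q_rev
    by (rule Q.bidirected_derived_graph)
  have kernel: "subgroup (kernel A Q j) A"
    by (rule j.subgroup_kernel)
  interpret N: group N_group
    by (rule A.subgroup_imp_group[OF kernel])
  have closed: "kernel_voltage A Q j \<kappa> \<phi> (x, q) \<in> kernel A Q j"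
    if "x \<in> arcs \<Gamma>" "q \<in> carrier Q" for x q
    using that
    by (auto simp: kernel_voltage_def quotient_voltage_def voltage_closed
        intro!: section_quotient_in_kernel)
  have "kernel_voltage A Q j \<kappa> \<phi> (Q_rev (x, q)) = inv\<^bsub>A\<^esub> (kernel_voltage A Q j \<kappa> \<phi> (x, q))"
    if "x \<in> arcs \<Gamma>" "q \<in> carrier Q" for x q
  proof -
    have "q \<otimes>\<^bsub>Q\<^esub> quotient_voltage j \<phi> x \<otimes>\<^bsub>Q\<^esub> quotient_voltage j \<phi> (arev x) = q"
      using that by (rule Q.voltage_rev_cancel)
    then show ?thesis
      using that Q.voltage_closed[of x]
      by (simp add: kernel_voltage_def voltage_closed voltage_rev A.inv_mult_group A.m_assoc)
  qed
  then show ?thesis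
    by unfold_locales (auto simp: closed A.m_inv_consistent[OF kernel])
qed

text \<open>
  The \<open>N\<close>-coordinate \<open>g \<otimes> inv (\<kappa> (j g))\<close> ends with the inverse of the element with which
  \<open>kernel_voltage\<close> begins at \<open>q = j g\<close>, so multiplying them yields the \<open>N\<close>-coordinate of
  \<open>g \<otimes> \<phi> x\<close>.  The same cancellation governs the reversal.
\<close>

lemma Xi_head:
  assumes "x \<in> arcs \<Gamma>" "g \<in> carrier A"
  shows "Xi A j \<kappa> (head (derived_graph \<Gamma> A \<phi>) (x, g)) =
    head (derived_graph Q_graph N_group (kernel_voltage A Q j \<kappa> \<phi>)) (Xi A j \<kappa> (x, g))"
  using assms voltage_closed[of x]
  by (simp add: Xi_def kernel_voltage_def quotient_voltage_def A.m_assoc inv_mult_cancel_left)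

lemma Xi_rev:
  assumes "x \<in> arcs \<Gamma>" "g \<in> carrier A"
  shows "Xi A j \<kappa> (derived_rev \<Gamma> arev A \<phi> (x, g)) =
    derived_rev Q_graph Q_rev N_group (kernel_voltage A Q j \<kappa> \<phi>) (Xi A j \<kappa> (x, g))"
  using assms voltage_closed[of x] section_quotient_in_kernel[of g "j g"]
  by (simp add: Xi_def kernel_voltage_def quotient_voltage_def A.m_assoc inv_mult_cancel_left)

lemma Xi_graph_iso:
  "graph_iso (derived_graph \<Gamma> A \<phi>) (derived_rev \<Gamma> arev A \<phi>)
     (derived_graph Q_graph N_group (kernel_voltage A Q j \<kappa> \<phi>))
     (derived_rev Q_graph Q_rev N_group (kernel_voltage A Q j \<kappa> \<phi>))
     (Xi A j \<kappa>) (Xi A j \<kappa>)"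
proof -
  have "tail (derived_graph Q_graph N_group (kernel_voltage A Q j \<kappa> \<phi>)) (Xi A j \<kappa> (x, g)) =
      Xi A j \<kappa> (tail (derived_graph \<Gamma> A \<phi>) (x, g))" for x g
    by (simp add: Xi_def)
  then show ?thesis
    by (auto simp: graph_iso_def Xi_bij Xi_head Xi_rev 
        simp del: tail_derived_graph head_derived_graph derived_rev_arc)
qed

lemma Xi_group_cover_equivalence:
  "group_cover_equivalence A \<Gamma> arev (derived_cover \<Gamma> arev A \<phi>)
     (iterated_cover \<Gamma> arev A (kernel A Q j) Q j \<kappa> \<phi>) (Xi A j \<kappa>) (Xi A j \<kappa>)"
proof -
  let ?C = "derived_cover \<Gamma> arev A \<phi>" and ?D = "iterated_cover \<Gamma> arev A (kernel A Q j) Q j \<kappa> \<phi>"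
  interpret N: voltage_assignment Q_graph Q_rev N_group "kernel_voltage A Q j \<kappa> \<phi>"
    by (rule kernel_voltage_assignment)
  have graph: "bidirected_digraph (total ?D) (total_rev ?D)"
    using N.bidirected_derived_graph by (simp add: iterated_cover_def)
  have iso: "graph_iso (total ?C) (total_rev ?C) (total ?D) (total_rev ?D) (Xi A j \<kappa>) (Xi A j \<kappa>)"
    using Xi_graph_iso by (simp add: derived_cover_def iterated_cover_def)
  have proj: "vproj ?D (Xi A j \<kappa> u) = vproj ?C u" "aproj ?D (Xi A j \<kappa> x) = aproj ?C x" for u x
    by (auto simp: derived_cover_def iterated_cover_def Xi_def split: prod.split)
  have vact: "Xi A j \<kappa> (vact ?C g u) = vact ?D g (Xi A j \<kappa> u)"
    if "g \<in> carrier A" "u \<in> verts (total ?C)" for g u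
    using that Xi_equivariant by (auto simp: derived_cover_def iterated_cover_def)
  have aact: "Xi A j \<kappa> (aact ?C g x) = aact ?D g (Xi A j \<kappa> x)"
    if "g \<in> carrier A" "x \<in> arcs (total ?C)" for g x
    using that Xi_equivariant by (auto simp: derived_cover_def iterated_cover_def)
  have "group_cover A ?D \<Gamma> arev"
    by (rule group_cover_transport
        [OF A.is_group group_cover_derived_cover graph iso proj(1) proj(2) vact aact])
  then show ?thesis
    unfolding group_cover_equivalence_def
    by (intro conjI ballI group_cover_derived_cover iso proj vact aact)
qed

end

theorem theorem3p1:
  fixes \<Gamma> :: "('v, 'e) pre_digraph" and arev :: "'e \<Rightarrow> 'e"
    and A :: "('a, 'm) monoid_scheme" and N :: "'a set" and Q :: "('q, 'n) monoid_scheme"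
    and j :: "'a \<Rightarrow> 'q" and \<kappa> :: "'q \<Rightarrow> 'a" and \<phi> :: "'e \<Rightarrow> 'a"
  assumes graph: "bidirected_digraph \<Gamma> arev" "fin_digraph \<Gamma>" "Digraph_Component.connected \<Gamma>"
    and groups: "group A" "finite (carrier A)" "group Q"
    and extension: "subgroup N A" "j \<in> hom A Q" "j ` carrier A = carrier Q" "kernel A Q j = N"
    and cross_section: "\<kappa> \<in> carrier Q \<rightarrow> carrier A" "\<And>q. q \<in> carrier Q \<Longrightarrow> j (\<kappa> q) = q"
      "\<kappa> \<one>\<^bsub>Q\<^esub> = \<one>\<^bsub>A\<^esub>"
    and voltage: "voltage_assignment \<Gamma> arev A \<phi>"
  shows "voltage_assignment \<Gamma> arev Q (quotient_voltage j \<phi>)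
    \<and> voltage_assignment (derived_graph \<Gamma> Q (quotient_voltage j \<phi>))
         (derived_rev \<Gamma> arev Q (quotient_voltage j \<phi>))
         (A\<lparr>carrier := N\<rparr>) (kernel_voltage A Q j \<kappa> \<phi>)
    \<and> group_cover_equivalence A \<Gamma> arev
         (derived_cover \<Gamma> arev A \<phi>) (iterated_cover \<Gamma> arev A N Q j \<kappa> \<phi>)
         (Xi A j \<kappa>) (Xi A j \<kappa>)"
proof -
  interpret extension_voltage \<Gamma> arev A Q j \<kappa> \<phi>
    using groups extension(2) cross_section(1,2) voltage
    by (auto simp: extension_voltage_def extension_with_section_def
        extension_with_section_axioms_def)
  show ?thesis
    using quotient_voltage_assignment kernel_voltage_assignment Xi_group_cover_equivalence
    unfolding extension(4) by blast
qed

end
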